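(* Let $Q$ be a stably Gelfand quantale, and let $b\in Q$ be a projection. Then: (1) $\mathcal I_b(Q)$, with the multiplication of $Q$, is a pseudogroup. (2) The idempotents of $\mathcal I_b(Q)$ coincide with the two-sided elements of the subquantale ${\downarrow}b=\{a\in Q\mid a\le b\}$; that is, $\{f\in\mathcal I_b(Q)\mid ff=f\}=\{a\in Q\mid a\le b,\ ab\le a,\ ba\le a\}$.
   Context: An involutive quantale is a complete lattice $Q$ with an associative multiplication that preserves arbitrary joins in each variable and a join-preserving involution $a\mapsto a^*$ satisfying $a^{**}=a$ and $(ab)^*=b^*a^*$ (a multiplicative unit is not assumed). $Q$ is stably Gelfand if for every $a\in Q$, $aa^*a\le a$ implies $aa^*a=a$. A projection of $Q$ is an element $b\in Q$ with $b^2=b=b^*$. For $b\in Q$, $$\mathcal I_b(Q)=\{s\in Q\mid s^*s\le b,\ ss^*\le b,\ sb\le s,\ bs\le s\}.$$ If $b$ is a projection, ${\downarrow}b$ is an involutive subquantale of $Q$ (closed under joins, multiplication and involution) whose top element is $b$; a two-sided element of an involutive quantale with top element $1$ is an element $a$ such that $a1\le a$ and $1a\le a$. A pseudogroup is a complete and infinitely distributive inverse semigroup $S$: with respect to the natural order, every compatible subset $Y\subset S$ (i.e. such that $st^{-1}$ and $s^{-1}t$ are idempotent for all $s,t\in Y$; the empty set is allowed) has a join, and multiplication by any element on the left or on the right preserves existing joins. *)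

theory Defs
  imports Main
begin

class involutive_quantale = complete_lattice + semigroup_mult +
  fixes invol :: "'a \<Rightarrow> 'a"  ("_\<^sup>\<star>" [1000] 999)
  assumes mult_Sup_distrib_left: "a * Sup A = (SUP x\<in>A. a * x)"
    and mult_Sup_distrib_right: "Sup A * a = (SUP x\<in>A. x * a)"
    and invol_Sup: "(Sup A)\<^sup>\<star> = (SUP x\<in>A. x\<^sup>\<star>)"
    and invol_invol: "(a\<^sup>\<star>)\<^sup>\<star> = a"
    and invol_mult: "(a * c)\<^sup>\<star> = c\<^sup>\<star> * a\<^sup>\<star>"

class stably_Gelfand_quantale = involutive_quantale +
  assumes stably_Gelfand: "a * a\<^sup>\<star> * a \<le> a \<Longrightarrow> a * a\<^sup>\<star> * a = a"

definition projection :: "'a::involutive_quantale \<Rightarrow> bool" where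
  "projection b \<longleftrightarrow> b * b = b \<and> b\<^sup>\<star> = b"

definition partial_units :: "'a::involutive_quantale \<Rightarrow> 'a set" where
  "partial_units b = {s. s\<^sup>\<star> * s \<le> b \<and> s * s\<^sup>\<star> \<le> b \<and> s * b \<le> s \<and> b * s \<le> s}"

locale inverse_semigroup =
  fixes S :: "'a set" and mul :: "'a \<Rightarrow> 'a \<Rightarrow> 'a"  (infixl "\<cdot>" 70)
  assumes closed: "s \<in> S \<Longrightarrow> t \<in> S \<Longrightarrow> s \<cdot> t \<in> S"
    and assoc: "s \<in> S \<Longrightarrow> t \<in> S \<Longrightarrow> u \<in> S \<Longrightarrow> s \<cdot> t \<cdot> u = s \<cdot> (t \<cdot> u)"
    and ex1_inverse: "s \<in> S \<Longrightarrow> \<exists>!t. t \<in> S \<and> s \<cdot> t \<cdot> s = s \<and> t \<cdot> s \<cdot> t = t"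
begin

definition sinv :: "'a \<Rightarrow> 'a" where
  "sinv s = (THE t. t \<in> S \<and> s \<cdot> t \<cdot> s = s \<and> t \<cdot> s \<cdot> t = t)"

definition nat_le :: "'a \<Rightarrow> 'a \<Rightarrow> bool"  (infix "\<preceq>" 50) where
  "s \<preceq> t \<longleftrightarrow> (\<exists>e\<in>S. e \<cdot> e = e \<and> s = e \<cdot> t)"

definition compatible :: "'a set \<Rightarrow> bool" where
  "compatible Y \<longleftrightarrow> (\<forall>s\<in>Y. \<forall>t\<in>Y.
     (s \<cdot> sinv t) \<cdot> (s \<cdot> sinv t) = s \<cdot> sinv t \<and>
     (sinv s \<cdot> t) \<cdot> (sinv s \<cdot> t) = sinv s \<cdot> t)"

(* Joins are taken in S with respect to its natural order, not in an ambient lattice. *)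
definition is_join :: "'a set \<Rightarrow> 'a \<Rightarrow> bool" where
  "is_join Y j \<longleftrightarrow> j \<in> S \<and> (\<forall>y\<in>Y. y \<preceq> j) \<and> (\<forall>u\<in>S. (\<forall>y\<in>Y. y \<preceq> u) \<longrightarrow> j \<preceq> u)"

end

locale pseudogroup = inverse_semigroup +
  assumes complete: "Y \<subseteq> S \<Longrightarrow> compatible Y \<Longrightarrow> \<exists>j. is_join Y j"
    and distrib_left: "s \<in> S \<Longrightarrow> Y \<subseteq> S \<Longrightarrow> is_join Y j \<Longrightarrow> is_join ((\<lambda>y. s \<cdot> y) ` Y) (s \<cdot> j)"
    and distrib_right: "s \<in> S \<Longrightarrow> Y \<subseteq> S \<Longrightarrow> is_join Y j \<Longrightarrow> is_join ((\<lambda>y. y \<cdot> s) ` Y) (j \<cdot> s)"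

end

theory Submission
  imports Defs
begin

text \<open>
  Every partial unit \<open>s\<close> satisfies \<open>s s\<^sup>\<star> s \<le> b s \<le> s\<close>, so the stably Gelfand law gives
  \<open>s s\<^sup>\<star> s = s\<close>: partial units are regular, with \<open>s\<^sup>\<star>\<close> as an inverse.  The law also forces a
  two-sided element \<open>a\<close> of \<open>{..b}\<close> to be idempotent: \<open>a\<^sup>\<star> = a\<^sup>\<star> a a\<^sup>\<star> \<le> b a b \<le> a\<close>, hence
  \<open>a = a a\<^sup>\<star> a \<le> a a a \<le> a a \<le> a\<close>.  Conversely an idempotent partial unit \<open>f\<close> lies below \<open>b\<close>,
  because \<open>f = f f\<^sup>\<star> f = (f f\<^sup>\<star>) (f\<^sup>\<star> f)\<close>, where \<open>f\<^sup>\<star>\<close> is idempotent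
  too.  So the idempotents are the two-sided elements of \<open>{..b}\<close>; their product is their meet (\<open>two_sided_mult_eq_inf\<close>), they commute, and inverses
  are unique.

  The remaining axioms reduce to the quantale because the natural order is the restriction of
  the order of the quantale (\<open>nat_le_iff_le\<close>) and the join of a set of partial units \<open>Y\<close>, whenever it
  exists, is its supremum \<open>Sup Y\<close> in the quantale (\<open>is_join_iff_Sup\<close>).  Compatibility of
  \<open>Y\<close> says precisely that all products \<open>s\<^sup>\<star> t\<close> and \<open>s t\<^sup>\<star>\<close> lie below \<open>b\<close>, which makes \<open>Sup Y\<close> a
  partial unit; distributivity is then that of the quantale.
\<close>

section \<open>Monotonicity in involutive quantales\<close>

lemma quantale_mult_mono:
  fixes a c x y :: "'a::involutive_quantale"
  assumes "a \<le> c" and "x \<le> y"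
  shows "a * x \<le> c * y"
proof -
  have "Sup {a, c} = c" and "Sup {x, y} = y"
    using assms by (simp_all add: sup_absorb2)
  then have "a * y \<le> c * y" and "a * x \<le> a * y"
    using mult_Sup_distrib_right[of "{a, c}" y] mult_Sup_distrib_left[of a "{x, y}"]
    by (simp_all add: le_iff_sup)
  then show ?thesis by (rule order_trans[rotated])
qed

lemma invol_mono:
  fixes a c :: "'a::involutive_quantale"
  assumes "a \<le> c"
  shows "a\<^sup>\<star> \<le> c\<^sup>\<star>"
proof -
  have "Sup {a, c} = c"
    using assms by (simp add: sup_absorb2)
  then show ?thesis
    using invol_Sup[of "{a, c}"] by (simp add: le_iff_sup)
qed

section \<open>Partial units and two-sided elements\<close>

context
  fixes b :: "'a::stably_Gelfand_quantale"
  assumes b: "projection b"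
begin

lemma b_mult_b: "b * b = b" and invol_b: "b\<^sup>\<star> = b"
  using b by (simp_all add: projection_def)

lemma partial_unitsD:
  assumes "s \<in> partial_units b"
  shows "s\<^sup>\<star> * s \<le> b" and "s * s\<^sup>\<star> \<le> b" and "s * b \<le> s" and "b * s \<le> s"
  using assms by (simp_all add: partial_units_def)

lemma partial_units_invol:
  assumes "s \<in> partial_units b"
  shows "s\<^sup>\<star> \<in> partial_units b"
proof -
  have "s\<^sup>\<star> * b = (b * s)\<^sup>\<star>" and "b * s\<^sup>\<star> = (s * b)\<^sup>\<star>"
    by (simp_all add: invol_mult invol_b)
  then show ?thesis
    using partial_unitsD[OF assms] by (simp add: partial_units_def invol_invol invol_mono)
qed

lemma partial_units_mult:
  assumes s: "s \<in> partial_units b" and t: "t \<in> partial_units b"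
  shows "s * t \<in> partial_units b"
proof -
  note s' = partial_unitsD[OF s] and t' = partial_unitsD[OF t]
  have "(s * t)\<^sup>\<star> * (s * t) = t\<^sup>\<star> * ((s\<^sup>\<star> * s) * t)"
    by (simp add: invol_mult mult.assoc)
  also have "\<dots> \<le> t\<^sup>\<star> * (b * t)"
    using s'(1) by (intro quantale_mult_mono order_refl)
  also have "\<dots> \<le> t\<^sup>\<star> * t"
    using t'(4) by (intro quantale_mult_mono order_refl)
  also have "\<dots> \<le> b" by (rule t'(1))
  finally have 1: "(s * t)\<^sup>\<star> * (s * t) \<le> b" .
  have "(s * t) * (s * t)\<^sup>\<star> = (s * (t * t\<^sup>\<star>)) * s\<^sup>\<star>"
    by (simp add: invol_mult mult.assoc)
  also have "\<dots> \<le> (s * b) * s\<^sup>\<star>"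
    using t'(2) by (intro quantale_mult_mono order_refl)
  also have "\<dots> \<le> s * s\<^sup>\<star>"
    using s'(3) by (intro quantale_mult_mono order_refl)
  also have "\<dots> \<le> b" by (rule s'(2))
  finally have 2: "(s * t) * (s * t)\<^sup>\<star> \<le> b" .
  have 3: "(s * t) * b \<le> s * t"
    using quantale_mult_mono[OF order_refl t'(3), of s] by (simp add: mult.assoc)
  have 4: "b * (s * t) \<le> s * t"
    using quantale_mult_mono[OF s'(4) order_refl, of t] by (simp add: mult.assoc)
  from 1 2 3 4 show ?thesis by (simp add: partial_units_def)
qed

lemma partial_units_regular:
  assumes "s \<in> partial_units b"
  shows "s * s\<^sup>\<star> * s = s"
proof (rule stably_Gelfand)
  have "s * s\<^sup>\<star> * s \<le> b * s"
    using partial_unitsD(2)[OF assms] by (intro quantale_mult_mono order_refl)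
  also have "\<dots> \<le> s" by (rule partial_unitsD(4)[OF assms])
  finally show "s * s\<^sup>\<star> * s \<le> s" .
qed

lemma two_sided_partial_unit:
  assumes "a \<le> b" and "a * b \<le> a" and "b * a \<le> a"
  shows "a \<in> partial_units b"
proof -
  have "a\<^sup>\<star> \<le> b" using invol_mono[OF assms(1)] by (simp add: invol_b)
  then have "a\<^sup>\<star> * a \<le> b * b" and "a * a\<^sup>\<star> \<le> b * b"
    using assms(1) by (auto intro: quantale_mult_mono)
  then show ?thesis using assms by (simp add: partial_units_def b_mult_b)
qed

lemma two_sided_idem:
  assumes "a \<le> b" and "a * b \<le> a" and "b * a \<le> a"
  shows "a * a = a"
proof (rule antisym)
  have a: "a \<in> partial_units b" by (rule two_sided_partial_unit[OF assms])
  have "a * a \<le> a * b"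
    using assms(1) by (intro quantale_mult_mono order_refl)
  also have "\<dots> \<le> a" by (rule assms(2))
  finally show "a * a \<le> a" .
  have "a\<^sup>\<star> \<le> a"
  proof -
    have "a\<^sup>\<star> = (a * a\<^sup>\<star> * a)\<^sup>\<star>" by (simp add: partial_units_regular[OF a])
    also have "\<dots> = (a\<^sup>\<star> * a) * a\<^sup>\<star>" by (simp add: invol_mult invol_invol mult.assoc)
    also have "\<dots> \<le> (b * a) * b"
      using assms(1) invol_mono[OF assms(1)]
      by (intro quantale_mult_mono) (simp_all add: invol_b)
    also have "\<dots> \<le> a * b"
      using assms(3) by (intro quantale_mult_mono order_refl)
    also have "\<dots> \<le> a" by (rule assms(2))
    finally show ?thesis .
  qed
  then have "a * a\<^sup>\<star> * a \<le> a * a * a"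
    by (intro quantale_mult_mono order_refl)
  then have "a \<le> (a * a) * a" by (simp add: partial_units_regular[OF a])
  also have "\<dots> \<le> a * a"
    using \<open>a * a \<le> a\<close> by (intro quantale_mult_mono order_refl)
  finally show "a \<le> a * a" .
qed

lemma partial_unit_idem_le:
  assumes "f \<in> partial_units b" and "f * f = f"
  shows "f \<le> b"
proof -
  have "f\<^sup>\<star> * f\<^sup>\<star> = f\<^sup>\<star>"
    using assms(2) by (metis invol_mult)
  then have "(f * f\<^sup>\<star>) * (f\<^sup>\<star> * f) = f * f\<^sup>\<star> * f"
    by (simp add: mult.assoc flip: mult.assoc[of "f\<^sup>\<star>" "f\<^sup>\<star>" f])
  then have "f = (f * f\<^sup>\<star>) * (f\<^sup>\<star> * f)"
    by (simp add: partial_units_regular[OF assms(1)])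
  also have "\<dots> \<le> b * b"
    using partial_unitsD[OF assms(1)] by (intro quantale_mult_mono)
  finally show ?thesis by (simp add: b_mult_b)
qed

lemma partial_unit_idem_iff_le:
  assumes "f \<in> partial_units b"
  shows "f * f = f \<longleftrightarrow> f \<le> b"
  using partial_unit_idem_le[OF assms] two_sided_idem partial_unitsD[OF assms] by blast

lemma idempotents_eq_two_sided:
  "{f \<in> partial_units b. f * f = f} = {a \<in> {..b}. a * b \<le> a \<and> b * a \<le> a}"
  using partial_unit_idem_iff_le partial_unitsD two_sided_partial_unit by auto

lemma two_sided_mult_eq_inf:
  assumes e: "e \<le> b" "e * b \<le> e" "b * e \<le> e"
    and f: "f \<le> b" "f * b \<le> f" "b * f \<le> f"
  shows "e * f = inf e f"
proof (rule antisym)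
  have "e * f \<le> e * b" and "e * f \<le> b * f"
    using e(1) f(1) by (auto intro: quantale_mult_mono)
  then show "e * f \<le> inf e f"
    using e(2) f(3) by (meson le_inf_iff order_trans)
  \<comment> \<open>The meet is itself two-sided below \<open>b\<close>, hence idempotent.\<close>
  have "inf e f * b \<le> inf e f"
    using order_trans[OF quantale_mult_mono[OF inf_le1 order_refl] e(2)]
      order_trans[OF quantale_mult_mono[OF inf_le2 order_refl] f(2)] by (rule le_infI)
  moreover have "b * inf e f \<le> inf e f"
    using order_trans[OF quantale_mult_mono[OF order_refl inf_le1] e(3)]
      order_trans[OF quantale_mult_mono[OF order_refl inf_le2] f(3)] by (rule le_infI)
  moreover have "inf e f \<le> b"
    using e(1) by (rule le_infI1)
  ultimately have "inf e f = inf e f * inf e f"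
    by (simp add: two_sided_idem)
  also have "\<dots> \<le> e * f"
    by (intro quantale_mult_mono inf_le1 inf_le2)
  finally show "inf e f \<le> e * f" .
qed

section \<open>The inverse semigroup of partial units\<close>

lemma partial_unit_idems_commute:
  assumes "e \<in> partial_units b" "e * e = e" "f \<in> partial_units b" "f * f = f"
  shows "e * f = f * e"
proof -
  note e = partial_unit_idem_le[OF assms(1,2)] partial_unitsD(3,4)[OF assms(1)]
  note f = partial_unit_idem_le[OF assms(3,4)] partial_unitsD(3,4)[OF assms(3)]
  show ?thesis
    by (simp only: two_sided_mult_eq_inf[OF e f] two_sided_mult_eq_inf[OF f e] inf_commute)
qed

lemma partial_units_inverse_unique:
  assumes s: "s \<in> partial_units b" and t: "t \<in> partial_units b" and u: "u \<in> partial_units b"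
    and st: "s * t * s = s" "t * s * t = t" and su: "s * u * s = s" "u * s * u = u"
  shows "t = u"
proof -
  have idem: "x * y \<in> partial_units b" "(x * y) * (x * y) = x * y"
    if "x \<in> partial_units b" "y \<in> partial_units b" "x * y * x = x" for x y
    using that(3) partial_units_mult[OF that(1,2)] by (simp_all flip: mult.assoc)
  \<comment> \<open>Both inverses equal \<open>t s u\<close>, because the idempotents \<open>s t\<close>, \<open>s u\<close> and \<open>t s\<close>, \<open>u s\<close> commute.\<close>
  have "t = t * (s * u * s) * t" using st su by simp
  also have "\<dots> = t * ((s * u) * (s * t))" by (simp only: mult.assoc)
  also have "(s * u) * (s * t) = (s * t) * (s * u)"
    using s t u st su by (intro partial_unit_idems_commute idem)
  also have "t * \<dots> = (t * s * t) * s * u" by (simp only: mult.assoc)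
  also have "\<dots> = t * s * u" using st by simp
  finally have "t = t * s * u" .
  have "u = u * (s * t * s) * u" using st su by simp
  also have "\<dots> = ((u * s) * (t * s)) * u" by (simp only: mult.assoc)
  also have "(u * s) * (t * s) = (t * s) * (u * s)"
    using s t u st su by (intro partial_unit_idems_commute idem)
  also have "\<dots> * u = t * s * (u * s * u)" by (simp only: mult.assoc)
  also have "\<dots> = t * s * u" using su by simp
  finally have "u = t * s * u" .
  with \<open>t = t * s * u\<close> show ?thesis by simp
qed

lemma partial_units_regular_invol:
  assumes "s \<in> partial_units b"
  shows "s\<^sup>\<star> * s * s\<^sup>\<star> = s\<^sup>\<star>"
  using partial_units_regular[OF partial_units_invol[OF assms]] by (simp add: invol_invol)

lemma inverse_semigroup_partial_units: "inverse_semigroup (partial_units b) (*)"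
proof
  fix s t u
  assume s: "s \<in> partial_units b"
  show "s * t * u = s * (t * u)" by (rule mult.assoc)
  show "s * t \<in> partial_units b" if "t \<in> partial_units b"
    using s that by (rule partial_units_mult)
  show "\<exists>!t. t \<in> partial_units b \<and> s * t * s = s \<and> t * s * t = t"
    using s partial_units_invol partial_units_regular partial_units_regular_invol
      partial_units_inverse_unique by (intro ex1I[of _ "s\<^sup>\<star>"]) auto
qed

interpretation inverse_semigroup "partial_units b" "(*)"
  by (rule inverse_semigroup_partial_units)

lemma sinv_eq_invol:
  assumes "s \<in> partial_units b"
  shows "sinv s = s\<^sup>\<star>"
  unfolding sinv_def
  using assms partial_units_invol partial_units_regular partial_units_regular_invol
  by (intro the1_equality ex1_inverse) auto

section \<open>Natural order and joins\<close>

lemma nat_le_iff_le: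
  assumes s: "s \<in> partial_units b" and t: "t \<in> partial_units b"
  shows "nat_le s t \<longleftrightarrow> s \<le> t"
proof
  assume "nat_le s t"
  then obtain e where e: "e \<in> partial_units b" "e * e = e" and "s = e * t"
    by (auto simp: nat_le_def)
  then have "s \<le> b * t"
    by (simp add: quantale_mult_mono partial_unit_idem_le)
  also have "\<dots> \<le> t" by (rule partial_unitsD(4)[OF t])
  finally show "s \<le> t" .
next
  assume "s \<le> t"
  \<comment> \<open>The idempotent witnessing the natural order is \<open>s s\<^sup>\<star>\<close>.\<close>
  have "s * s\<^sup>\<star> * t \<le> s * t\<^sup>\<star> * t"
    using \<open>s \<le> t\<close> by (intro quantale_mult_mono invol_mono order_refl)
  also have "\<dots> = s * (t\<^sup>\<star> * t)" by (rule mult.assoc)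
  also have "\<dots> \<le> s * b"
    using partial_unitsD(1)[OF t] by (intro quantale_mult_mono order_refl)
  also have "\<dots> \<le> s" by (rule partial_unitsD(3)[OF s])
  finally have "s * s\<^sup>\<star> * t \<le> s" .
  moreover have "s * s\<^sup>\<star> * s \<le> s * s\<^sup>\<star> * t"
    using \<open>s \<le> t\<close> by (intro quantale_mult_mono order_refl)
  ultimately have "s = (s * s\<^sup>\<star>) * t"
    by (simp add: partial_units_regular[OF s])
  moreover have "s * s\<^sup>\<star> \<in> partial_units b"
    using s partial_units_invol by (intro partial_units_mult)
  moreover have "(s * s\<^sup>\<star>) * (s * s\<^sup>\<star>) = s * s\<^sup>\<star>"
    using partial_units_regular[OF s] by (simp flip: mult.assoc)
  ultimately show "nat_le s t"
    unfolding nat_le_def by blast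
qed

lemma Sup_partial_unit:
  assumes Y: "Y \<subseteq> partial_units b"
    and le: "\<And>s t. s \<in> Y \<Longrightarrow> t \<in> Y \<Longrightarrow> s\<^sup>\<star> * t \<le> b \<and> s * t\<^sup>\<star> \<le> b"
  shows "Sup Y \<in> partial_units b"
proof -
  have "(Sup Y)\<^sup>\<star> * Sup Y \<le> b"
    using le by (simp add: invol_Sup mult_Sup_distrib_left mult_Sup_distrib_right SUP_le_iff
        image_image)
  moreover have "Sup Y * (Sup Y)\<^sup>\<star> \<le> b"
    using le by (simp add: invol_Sup mult_Sup_distrib_left mult_Sup_distrib_right SUP_le_iff
        image_image)
  moreover have "Sup Y * b \<le> Sup Y" and "b * Sup Y \<le> Sup Y"
    unfolding mult_Sup_distrib_left mult_Sup_distrib_right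
    using Y by (auto intro!: SUP_least intro: Sup_upper2 dest: partial_unitsD)
  ultimately show ?thesis by (simp add: partial_units_def)
qed

text \<open>
  A join is a least upper bound only among partial units, so it might a priori lie strictly above
  the supremum in the quantale.  It does not, because the supremum of a set of partial units that
  has an upper bound in the partial units is itself a partial unit.
\<close>

lemma is_join_iff_Sup:
  assumes Y: "Y \<subseteq> partial_units b"
  shows "is_join Y j \<longleftrightarrow> j \<in> partial_units b \<and> j = Sup Y"
proof
  assume j: "is_join Y j"
  then have jS: "j \<in> partial_units b" by (simp add: is_join_def)
  have upper: "y \<le> j" if "y \<in> Y" for y
    using j that Y jS nat_le_iff_le unfolding is_join_def by blast
  \<comment> \<open>Any upper bound \<open>j\<close> in the partial units bounds the products \<open>s\<^sup>\<star> t\<close> by \<open>j\<^sup>\<star> j \<le> b\<close>.\<close>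
  have "Sup Y \<in> partial_units b"
  proof (rule Sup_partial_unit[OF Y])
    fix s t assume "s \<in> Y" "t \<in> Y"
    then have "s\<^sup>\<star> * t \<le> j\<^sup>\<star> * j" and "s * t\<^sup>\<star> \<le> j * j\<^sup>\<star>"
      using upper by (auto intro: quantale_mult_mono invol_mono)
    then show "s\<^sup>\<star> * t \<le> b \<and> s * t\<^sup>\<star> \<le> b"
      using partial_unitsD[OF jS] by (meson order_trans)
  qed
  moreover from this have "\<forall>y\<in>Y. nat_le y (Sup Y)"
    using Y nat_le_iff_le by (auto intro: Sup_upper)
  ultimately have "j \<le> Sup Y"
    using j jS nat_le_iff_le unfolding is_join_def by blast
  with upper jS show "j \<in> partial_units b \<and> j = Sup Y"
    by (auto intro: antisym Sup_least)
next
  assume "j \<in> partial_units b \<and> j = Sup Y"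
  with Y nat_le_iff_le show "is_join Y j"
    by (auto simp: is_join_def subset_iff Sup_le_iff intro: Sup_upper)
qed

lemma pseudogroup_partial_units: "pseudogroup (partial_units b) (*)"
proof
  fix Y assume Y: "Y \<subseteq> partial_units b" and comp: "compatible Y"
  have "Sup Y \<in> partial_units b"
  proof (rule Sup_partial_unit[OF Y])
    fix s t assume st: "s \<in> Y" "t \<in> Y"
    then have "s \<in> partial_units b" "t \<in> partial_units b" using Y by auto
    moreover from this have "s\<^sup>\<star> * t \<in> partial_units b" "s * t\<^sup>\<star> \<in> partial_units b"
      by (auto intro: partial_units_mult partial_units_invol)
    ultimately show "s\<^sup>\<star> * t \<le> b \<and> s * t\<^sup>\<star> \<le> b"
      using bspec[OF bspec[OF comp[unfolded compatible_def] st(1)] st(2)]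
      by (simp add: sinv_eq_invol partial_unit_idem_le)
  qed
  then show "\<exists>j. is_join Y j" using is_join_iff_Sup[OF Y] by blast
next
  fix s Y j assume s: "s \<in> partial_units b" and Y: "Y \<subseteq> partial_units b" and j: "is_join Y j"
  have j': "j \<in> partial_units b" "j = Sup Y" using j is_join_iff_Sup[OF Y] by auto
  have "(\<lambda>y. s * y) ` Y \<subseteq> partial_units b" "(\<lambda>y. y * s) ` Y \<subseteq> partial_units b"
    using s Y by (auto intro: partial_units_mult)
  then show "is_join ((\<lambda>y. s * y) ` Y) (s * j)" "is_join ((\<lambda>y. y * s) ` Y) (j * s)"
    using s j' partial_units_mult[OF s j'(1)] partial_units_mult[OF j'(1) s]
    by (simp_all add: is_join_iff_Sup mult_Sup_distrib_left mult_Sup_distrib_right)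
qed

end

section \<open>The pseudogroup of a projection\<close>

theorem theorem2p3:
  fixes b :: "'a::stably_Gelfand_quantale"
  assumes "projection b"
  shows "pseudogroup (partial_units b) (*)
    \<and> {f \<in> partial_units b. f * f = f} = {a \<in> {..b}. a * b \<le> a \<and> b * a \<le> a}"
  using pseudogroup_partial_units[OF assms] idempotents_eq_two_sided[OF assms] by (rule conjI)

end
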